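(* Let $L$ be a (real) vector lattice with a distinguished strong unit $e>0$. Then the following are equivalent. (1) Every linear functional $H:L\rightarrow\mathbb{R}$ which is unital (i.e. $H(e)=1$) and unit preserving (i.e. $H(u)\neq 0$ for every strong unit $u\in L$) is a lattice homomorphism, i.e. satisfies $|H(x)|=H(|x|)$ for all $x\in L$. (2) $L$ is clean, i.e. every element of $L$ is clean.
   Context: $L$ is a real vector lattice (Riesz space); no Archimedean assumption is stated. An element $u\in L$ (not necessarily positive) is a strong unit if for every $x\in L$ there is a real $\alpha>0$ with $|x|\leq\alpha|u|$. A strong unit $e>0$ of $L$ is fixed. A component of $L$ is an element $p\in L$ with $p\wedge(e-p)=0$. An element $x\in L$ is clean if there exist a component $p$ of $L$ and a strong unit $u$ of $L$ with $x=p+u$. *)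

theory Defs
  imports Complex_Main "HOL-Library.Lattice_Algebras"
begin

(* Not Archimedean in general.  The absolute value is that of the lattice:
   lattice_ab_group_add_abs supplies |x| = sup x (- x). *)
class vector_lattice = ordered_real_vector + lattice_ab_group_add_abs

(* Strong units are not required to be positive. *)
definition strong_unit :: "'a::vector_lattice \<Rightarrow> bool" where
  "strong_unit u \<longleftrightarrow> (\<forall>x. \<exists>\<alpha>>0. \<bar>x\<bar> \<le> \<alpha> *\<^sub>R \<bar>u\<bar>)"

definition component :: "'a::vector_lattice \<Rightarrow> 'a \<Rightarrow> bool" where
  "component e p \<longleftrightarrow> inf p (e - p) = 0"

definition clean :: "'a::vector_lattice \<Rightarrow> 'a \<Rightarrow> bool" where
  "clean e x \<longleftrightarrow> (\<exists>p u. component e p \<and> strong_unit u \<and> x = p + u)"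

definition unital :: "'a::vector_lattice \<Rightarrow> ('a \<Rightarrow> real) \<Rightarrow> bool" where
  "unital e H \<longleftrightarrow> H e = 1"

definition unit_preserving :: "('a::vector_lattice \<Rightarrow> real) \<Rightarrow> bool" where
  "unit_preserving H \<longleftrightarrow> (\<forall>u. strong_unit u \<longrightarrow> H u \<noteq> 0)"

(* To be applied to linear H only. *)
definition lattice_hom :: "('a::vector_lattice \<Rightarrow> real) \<Rightarrow> bool" where
  "lattice_hom H \<longleftrightarrow> (\<forall>x. \<bar>H x\<bar> = H \<bar>x\<bar>)"

end

theory Submission
  imports Defs
begin

text \<open>
  A unital unit preserving functional \<open>H\<close> is positive and takes only the values \<open>0\<close> and \<open>1\<close> on
  components. If the lattice is clean, then for every \<open>\<epsilon> > 0\<close> some component separates the negative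
  part of \<open>x\<close> from the part of \<open>x\<close> above \<open>\<epsilon> e\<close>, so \<open>H\<close> vanishes on the negative part or is at most
  \<open>\<epsilon>\<close> on the positive part.

  Conversely, suppose that \<open>x\<close> is not clean. The components on which \<open>x\<close> is clean form a proper ideal
  of the Boolean algebra of components; extend it to a maximal ideal \<open>M\<close>. A strong unit has constant
  sign modulo \<open>M\<close>, so every positive unital functional vanishing on \<open>M\<close> is unit preserving. By the
  Hahn-Banach theorem there are two such functionals \<open>F\<close>, \<open>G\<close> with \<open>F x \<ge> 1\<close> and \<open>G x \<le> 0\<close>. Their
  midpoint \<open>H\<close> is not a lattice homomorphism: otherwise \<open>H \<bar>x - H x e\<bar> = 0\<close>, which forces
  \<open>F x = H x = G x\<close>.
\<close>

subsection \<open>Sublinear functionals\<close>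

text \<open>Homogeneity is asked for as an inequality only, which survives infima directly;
  \<open>sublinear_scale\<close> recovers equality by also scaling with
  \<open>inverse c\<close>.\<close>

definition sublinear :: "('a::real_vector \<Rightarrow> real) \<Rightarrow> bool" where
  "sublinear q \<longleftrightarrow> (\<forall>x y. q (x + y) \<le> q x + q y) \<and> (\<forall>c x. c \<ge> 0 \<longrightarrow> q (c *\<^sub>R x) \<le> c * q x)"

lemma sublinearI:
  assumes "\<And>x y. q (x + y) \<le> q x + q y" "q 0 \<le> 0" "\<And>c x. c > 0 \<Longrightarrow> q (c *\<^sub>R x) \<le> c * q x"
  shows "sublinear q"
  unfolding sublinear_def
proof (intro conjI allI impI)
  fix c :: real and x :: 'a assume "c \<ge> 0"
  then show "q (c *\<^sub>R x) \<le> c * q x"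
    using assms(2,3) by (cases "c = 0") auto
qed (use assms in auto)

lemma sublinear_add: "sublinear q \<Longrightarrow> q (x + y) \<le> q x + q y"
  by (simp add: sublinear_def)

lemma sublinear_scale_le: "sublinear q \<Longrightarrow> c \<ge> 0 \<Longrightarrow> q (c *\<^sub>R x) \<le> c * q x"
  by (simp add: sublinear_def)

lemma sublinear_zero: "sublinear q \<Longrightarrow> q 0 = 0"
  using sublinear_add[of q 0 0] sublinear_scale_le[of q 0 0] by simp

lemma sublinear_scale:
  assumes "sublinear q" "c \<ge> 0"
  shows "q (c *\<^sub>R x) = c * q x"
proof (cases "c = 0")
  case True
  then show ?thesis using sublinear_zero[OF assms(1)] by simp
next
  case False
  then have "c > 0" using assms by simp
  then have "q x \<le> inverse c * q (c *\<^sub>R x)"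
    using sublinear_scale_le[OF assms(1), of "inverse c" "c *\<^sub>R x"] by simp
  then have "c * q x \<le> q (c *\<^sub>R x)"
    using \<open>c > 0\<close> by (simp add: field_simps)
  then show ?thesis using sublinear_scale_le[OF assms] by (simp add: antisym)
qed

lemma sublinear_minus: "sublinear q \<Longrightarrow> - q (- x) \<le> q x"
  using sublinear_add[of q x "- x"] sublinear_zero[of q] by simp

text \<open>Take \<open>q' y\<close> as the infimum of
  \<open>q (y + t *\<^sub>R a) - t * q a\<close> over t \<ge> 0. Subadditivity bounds it below by
  \<open>- q (- y)\<close>; t = 0 gives \<open>q' \<le> q\<close>, and t = 1 at \<open>- a\<close>
  gives the last bound.\<close>

lemma sublinear_descend:
  assumes q: "sublinear q"
  shows "\<exists>q'. sublinear q' \<and> q' \<le> q \<and> q' (- a) \<le> - q a"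
proof -
  define f where "f y t = q (y + t *\<^sub>R a) - t * q a" for y t
  define q' where "q' y = (INF t\<in>{0..}. f y t)" for y
  have lb: "- q (- y) \<le> f y t" if "t \<ge> 0" for y t
  proof -
    have "q (t *\<^sub>R a) \<le> q (y + t *\<^sub>R a) + q (- y)"
      using sublinear_add[OF q, of "y + t *\<^sub>R a" "- y"] by simp
    then show ?thesis using sublinear_scale[OF q that] by (simp add: f_def)
  qed
  have bdd: "bdd_below (f y ` {0..})" for y
    using lb by (intro bdd_belowI2) auto
  have upper: "q' y \<le> f y t" if "t \<ge> 0" for y t
    unfolding q'_def using that by (intro cINF_lower[OF bdd]) auto
  have lower: "b \<le> q' y" if "\<And>t. t \<ge> 0 \<Longrightarrow> b \<le> f y t" for b y
    unfolding q'_def using that by (intro cINF_greatest) auto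
  have "sublinear q'"
  proof (rule sublinearI)
    fix x y
    have sum: "q' (x + y) \<le> f x s + f y t" if "s \<ge> 0" "t \<ge> 0" for s t
    proof -
      have "q' (x + y) \<le> f (x + y) (s + t)" using that by (intro upper) simp
      also have "\<dots> \<le> f x s + f y t"
        using sublinear_add[OF q, of "x + s *\<^sub>R a" "y + t *\<^sub>R a"]
        by (simp add: f_def algebra_simps)
      finally show ?thesis .
    qed
    have "q' (x + y) - f x s \<le> q' y" if "s \<ge> 0" for s
    proof (rule lower)
      fix t :: real assume "t \<ge> 0"
      then show "q' (x + y) - f x s \<le> f y t" using sum[OF that, of t] by simp
    qed
    then have "q' (x + y) - q' y \<le> q' x"
      by (intro lower) (simp add: algebra_simps)
    then show "q' (x + y) \<le> q' x + q' y" by simp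
  next
    show "q' 0 \<le> 0" using upper[of 0 0] sublinear_zero[OF q] by (simp add: f_def)
  next
    fix c :: real and x assume c: "c > 0"
    have "inverse c * q' (c *\<^sub>R x) \<le> q' x"
    proof (rule lower)
      fix t :: real assume "t \<ge> 0"
      then have "q' (c *\<^sub>R x) \<le> f (c *\<^sub>R x) (c * t)" using c by (intro upper) simp
      also have "\<dots> = c * f x t"
        using sublinear_scale[OF q, of c "x + t *\<^sub>R a"] c by (simp add: f_def algebra_simps)
      finally show "inverse c * q' (c *\<^sub>R x) \<le> f x t" using c by (simp add: field_simps)
    qed
    then show "q' (c *\<^sub>R x) \<le> c * q' x" using c by (simp add: field_simps)
  qed
  moreover have "q' \<le> q" using upper[of 0] by (simp add: le_fun_def f_def)
  moreover have "q' (- a) \<le> - q a"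
    using upper[of 1 "- a"] sublinear_zero[OF q] by (simp add: f_def)
  ultimately show ?thesis by blast
qed

text \<open>The pointwise infimum works: all members are at least \<open>- p (- y)\<close> at
  \<open>y\<close>, and the chain condition lets two members be replaced by a common smaller one,
  which yields subadditivity.\<close>

lemma sublinear_INF_chain:
  assumes "C \<noteq> {}" and sub: "\<And>q. q \<in> C \<Longrightarrow> sublinear q \<and> q \<le> p"
    and chain: "\<And>q r. q \<in> C \<Longrightarrow> r \<in> C \<Longrightarrow> q \<le> r \<or> r \<le> q"
  shows "\<exists>u. sublinear u \<and> (\<forall>q\<in>C. u \<le> q)"
proof -
  define u where "u y = (INF q\<in>C. q y)" for y
  have lb: "- p (- y) \<le> q y" if "q \<in> C" for q y
    using sub[OF that] sublinear_minus[of q y] le_funD[of q p "- y"] by linarith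
  have upper: "u y \<le> q y" if "q \<in> C" for q y
    unfolding u_def using that lb by (intro cINF_lower) (auto intro!: bdd_belowI2)
  have lower: "b \<le> u y" if "\<And>q. q \<in> C \<Longrightarrow> b \<le> q y" for b y
    unfolding u_def using that assms(1) by (intro cINF_greatest) auto
  have "sublinear u"
  proof (rule sublinearI)
    fix x y
    have sum: "u (x + y) \<le> q x + r y" if qr: "q \<in> C" "r \<in> C" for q r
    proof -
      obtain s where s: "s \<in> C" "s \<le> q" "s \<le> r"
        using chain[OF qr] qr by auto
      have "u (x + y) \<le> s (x + y)" by (rule upper[OF s(1)])
      also have "\<dots> \<le> s x + s y" using sub[OF s(1)] by (simp add: sublinear_add)
      also have "\<dots> \<le> q x + r y" using s by (intro add_mono) (auto simp: le_fun_def)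
      finally show ?thesis .
    qed
    have "u (x + y) - q x \<le> u y" if "q \<in> C" for q
      using sum[OF that] by (intro lower) (simp add: algebra_simps)
    then have "u (x + y) - u y \<le> u x"
      by (intro lower) (simp add: algebra_simps)
    then show "u (x + y) \<le> u x + u y" by simp
  next
    show "u 0 \<le> 0" using assms(1) upper[of _ 0] sub sublinear_zero by fastforce
  next
    fix c :: real and x assume c: "c > 0"
    have "inverse c * u (c *\<^sub>R x) \<le> u x"
    proof (rule lower)
      fix q assume "q \<in> C"
      then have "u (c *\<^sub>R x) \<le> c * q x"
        using upper[of q "c *\<^sub>R x"] sub[of q] sublinear_scale[of q c x] c by simp
      then show "inverse c * u (c *\<^sub>R x) \<le> q x" using c by (simp add: field_simps)
    qed
    then show "u (c *\<^sub>R x) \<le> c * u x" using c by (simp add: field_simps)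
  qed
  then show ?thesis using upper by (auto simp: le_fun_def)
qed

text \<open>A sublinear functional that is minimal below \<open>p\<close> is odd, since one could descend further otherwise; hence it is linear.\<close>

lemma hahn_banach_sublinear:
  assumes p: "sublinear p"
  shows "\<exists>f. linear f \<and> (\<forall>x. f x \<le> p x) \<and> f a = p a"
proof -
  \<comment> \<open>Descending first forces the value at \<open>a\<close>: a linear \<open>f\<close>
    below \<open>p'\<close> satisfies \<open>f (- a) \<le> - p a\<close>, hence
    \<open>p a \<le> f a\<close>.\<close>
  obtain p' where p': "sublinear p'" "p' \<le> p" "p' (- a) \<le> - p a"
    using sublinear_descend[OF p] by blast
  define A where "A = {q. sublinear q \<and> q \<le> p'}"
  have "\<exists>m\<in>A. \<forall>q\<in>A. q \<le> m \<longrightarrow> q = m"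
  \<comment> \<open>Zorn is applied to the reversed order, so chains need lower bounds and the
    maximal element is a minimal functional.\<close>
  proof (rule predicate_Zorn)
    show "partial_order_on A (relation_of (\<lambda>m q. q \<le> m) A)"
      by (rule partial_order_on_relation_ofI) auto
  next
    fix C assume C: "C \<in> Chains (relation_of (\<lambda>m q. q \<le> m) A)"
    then have CA: "C \<subseteq> A" and ch: "\<And>q r. q \<in> C \<Longrightarrow> r \<in> C \<Longrightarrow> q \<le> r \<or> r \<le> q"
      by (auto simp: Chains_def relation_of_def)
    show "\<exists>u\<in>A. \<forall>q\<in>C. u \<le> q"
    proof (cases "C = {}")
      case True
      then show ?thesis using p' by (auto simp: A_def)
    next
      case False
      have sub: "sublinear q \<and> q \<le> p'" if "q \<in> C" for q
        using CA that by (auto simp: A_def)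
      obtain u where u: "sublinear u" "\<forall>q\<in>C. u \<le> q"
        using sublinear_INF_chain[OF False sub ch] by blast
      then have "u \<le> p'" using False sub by (meson ex_in_conv order_trans)
      then show ?thesis using u by (auto simp: A_def)
    qed
  qed
  then obtain f where f: "sublinear f" "f \<le> p'"
    and min: "\<And>q. sublinear q \<Longrightarrow> q \<le> f \<Longrightarrow> q = f"
    unfolding A_def by (auto intro: order_trans)
  have odd: "f (- x) = - f x" for x
  proof (rule antisym)
    show "f (- x) \<le> - f x" using sublinear_descend[OF f(1)] min by blast
    show "- f x \<le> f (- x)" using sublinear_minus[OF f(1), of "- x"] by simp
  qed
  have "linear f"
  proof (rule linearI)
    fix x y
    have "f (- x + - y) \<le> f (- x) + f (- y)" by (rule sublinear_add[OF f(1)])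
    then have "f x + f y \<le> f (x + y)" using odd[of "x + y"] by (simp add: odd)
    then show "f (x + y) = f x + f y" using sublinear_add[OF f(1)] by (simp add: antisym)
  next
    fix c :: real and x
    show "f (c *\<^sub>R x) = c *\<^sub>R f x"
    proof (cases "c \<ge> 0")
      case True
      then show ?thesis using sublinear_scale[OF f(1)] by simp
    next
      case False
      then have "f ((- c) *\<^sub>R x) = (- c) * f x" by (intro sublinear_scale[OF f(1)]) simp
      then show ?thesis using odd[of "c *\<^sub>R x"] by simp
    qed
  qed
  moreover have le: "f x \<le> p x" for x
    using f(2) p'(2) by (auto simp: le_fun_def intro: order_trans)
  moreover have "p a \<le> f a"
    using le_funD[OF f(2), of "- a"] p'(3) odd[of a] by linarith
  ultimately show ?thesis using le by (meson antisym)
qed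

subsection \<open>Disjointness, components and strong units\<close>

lemma scaleR_inf:
  fixes a b :: "'a::vector_lattice"
  assumes "r > 0"
  shows "r *\<^sub>R inf a b = inf (r *\<^sub>R a) (r *\<^sub>R b)"
proof (rule antisym)
  show "r *\<^sub>R inf a b \<le> inf (r *\<^sub>R a) (r *\<^sub>R b)"
    using assms by (simp add: scaleR_left_mono)
  have "inverse r *\<^sub>R inf (r *\<^sub>R a) (r *\<^sub>R b) \<le> inf a b"
    using assms scaleR_left_mono[of "inf (r *\<^sub>R a) (r *\<^sub>R b)" "r *\<^sub>R a" "inverse r"]
      scaleR_left_mono[of "inf (r *\<^sub>R a) (r *\<^sub>R b)" "r *\<^sub>R b" "inverse r"] by simp
  then have "r *\<^sub>R (inverse r *\<^sub>R inf (r *\<^sub>R a) (r *\<^sub>R b)) \<le> r *\<^sub>R inf a b"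
    using assms by (intro scaleR_left_mono) auto
  then show "inf (r *\<^sub>R a) (r *\<^sub>R b) \<le> r *\<^sub>R inf a b" using assms by simp
qed

lemma scaleR_pprt:
  fixes a :: "'a::vector_lattice"
  assumes "r > 0"
  shows "r *\<^sub>R pprt a = pprt (r *\<^sub>R a)"
proof -
  have "r *\<^sub>R sup a 0 = - (r *\<^sub>R inf (- a) (- 0))"
    by (simp only: sup_eq_neg_inf[of a 0] scaleR_minus_right)
  also have "\<dots> = sup (r *\<^sub>R a) 0"
    unfolding scaleR_inf[OF assms] by (subst sup_eq_neg_inf) simp
  finally show ?thesis by (simp add: pprt_def)
qed

lemma disjoint_nonneg:
  fixes a b :: "'a::vector_lattice"
  assumes "inf a b = 0"
  shows "0 \<le> a" "0 \<le> b"
  using assms by (metis inf.cobounded1 inf.cobounded2)+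

lemma disjoint_mono:
  fixes a b :: "'a::vector_lattice"
  assumes "inf a b = 0" "0 \<le> c" "c \<le> a" "0 \<le> d" "d \<le> b"
  shows "inf c d = 0"
  using assms inf_mono[of c a d b] by (simp add: antisym)

text \<open>After moving \<open>inf a b\<close> to the left, the difference lies below both
  \<open>a\<close> and \<open>c\<close>.\<close>

lemma inf_add_le:
  fixes a b c :: "'a::vector_lattice"
  assumes "0 \<le> a" "0 \<le> b" "0 \<le> c"
  shows "inf a (b + c) \<le> inf a b + inf a c"
proof -
  have "inf a (b + c) - inf a b \<le> inf a c"
  proof (rule inf_greatest)
    have "inf a (b + c) \<le> a + inf a b" using assms by (intro add_increasing2) auto
    then show "inf a (b + c) - inf a b \<le> a" by (simp only: diff_le_eq)
    have "inf a (b + c) \<le> inf a b + c"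
      unfolding add_inf_distrib_right using assms by (simp add: add_increasing2 le_infI1)
    then show "inf a (b + c) - inf a b \<le> c" by (simp only: diff_le_eq add.commute)
  qed
  then show ?thesis by (simp only: diff_le_eq add.commute)
qed

lemma disjoint_add:
  fixes a b c :: "'a::vector_lattice"
  assumes "inf a b = 0" "inf a c = 0"
  shows "inf a (b + c) = 0"
  using inf_add_le[of a b c] assms disjoint_nonneg[OF assms(1)] disjoint_nonneg[OF assms(2)]
  by (simp add: antisym)

lemma disjoint_scaleR:
  fixes a b :: "'a::vector_lattice"
  assumes "inf a b = 0" "0 \<le> r"
  shows "inf a (r *\<^sub>R b) = 0"
proof -
  note nn = disjoint_nonneg[OF assms(1)]
  \<comment> \<open>One factor that dominates both 1 and \<open>r\<close>: scaling \<open>a\<close>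
    and \<open>b\<close> by it keeps them disjoint, and \<open>a\<close> and
    \<open>r *\<^sub>R b\<close> lie below the results.\<close>
  define s where "s = max 1 r"
  have s: "s > 0" "1 \<le> s" "r \<le> s" by (auto simp: s_def)
  have "inf (s *\<^sub>R a) (s *\<^sub>R b) = 0"
    using scaleR_inf[OF s(1), of a b] assms(1) by simp
  moreover have "a \<le> s *\<^sub>R a" using scaleR_right_mono[OF s(2) nn(1)] by simp
  moreover have "r *\<^sub>R b \<le> s *\<^sub>R b" by (rule scaleR_right_mono[OF s(3) nn(2)])
  moreover have "0 \<le> r *\<^sub>R b" using assms(2) nn(2) by (simp add: scaleR_nonneg_nonneg)
  ultimately show ?thesis using disjoint_mono nn(1) by metis
qed

text \<open>The tool for localizing to a band: an error term disjoint from \<open>a\<close> may be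
  dropped, because \<open>a = inf a (b + c)\<close> splits.\<close>

lemma disjoint_cancel:
  fixes a b c :: "'a::vector_lattice"
  assumes "inf a c = 0" "0 \<le> b" "a \<le> b + c"
  shows "a \<le> b"
proof -
  have "a = inf a (b + c)" using assms(3) by (simp add: inf_absorb1)
  also have "\<dots> \<le> inf a b + inf a c"
    using assms disjoint_nonneg[OF assms(1)] by (intro inf_add_le)
  also have "\<dots> \<le> b" using assms(1) by simp
  finally show ?thesis .
qed

lemma disjoint_sup:
  fixes a b c :: "'a::vector_lattice"
  assumes "inf a b = 0" "inf a c = 0"
  shows "inf a (sup b c) = 0"
proof (rule disjoint_mono[OF disjoint_add[OF assms]])
  note nn = disjoint_nonneg[OF assms(1)] disjoint_nonneg[OF assms(2)]
  show "0 \<le> sup b c" using nn by (simp add: le_supI1)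
  show "sup b c \<le> b + c" using nn by (simp add: add_increasing add_increasing2)
qed (use disjoint_nonneg[OF assms(1)] in auto)

text \<open>Cancelling \<open>b\<close> in \<open>a \<le> \<bar>a - b\<bar> + b\<close>, and
  symmetrically \<open>a\<close>, bounds \<open>sup a b\<close>, which is \<open>a + b\<close> by
  disjointness.\<close>

lemma abs_diff_disjoint:
  fixes a b :: "'a::vector_lattice"
  assumes "inf a b = 0"
  shows "a + b \<le> \<bar>a - b\<bar>"
proof -
  have "a \<le> \<bar>a - b\<bar> + b" using abs_ge_self[of "a - b"] by (simp add: algebra_simps)
  moreover have "b \<le> \<bar>a - b\<bar> + a"
    using abs_ge_minus_self[of "a - b"] by (simp add: algebra_simps)
  ultimately have "sup a b \<le> \<bar>a - b\<bar>"
    using disjoint_cancel[of a b] disjoint_cancel[of b a] assms by (simp add: inf_commute)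
  then show ?thesis using add_eq_inf_sup[of a b] assms by simp
qed

text \<open>Translation by \<open>nprt a\<close> turns the two positive parts into \<open>a\<close>
  and 0, whose infimum is \<open>nprt a\<close> again.\<close>

lemma pprt_minus_disjoint:
  fixes a :: "'a::vector_lattice"
  shows "inf (pprt a) (pprt (- a)) = 0"
proof -
  have "nprt a + inf (pprt a) (pprt (- a)) = inf a 0"
    unfolding add_inf_distrib_left using prts[of a] pprt_neg[of a] by (simp add: add.commute)
  then show ?thesis by (simp add: nprt_def)
qed

lemma abs_eq_pprt_add:
  fixes a :: "'a::vector_lattice"
  shows "\<bar>a\<bar> = pprt a + pprt (- a)" "a = pprt a - pprt (- a)"
  using abs_prts[of a] prts[of a] pprt_neg[of a] by simp_all

section \<open>The Boolean algebra of components\<close>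

lemma componentD:
  assumes "component e p"
  shows "0 \<le> p" "p \<le> e" "inf p (e - p) = 0"
  using assms disjoint_nonneg[of p "e - p"] by (auto simp: component_def)

lemma component_compl: "component e p \<Longrightarrow> component e (e - p)"
  by (simp add: component_def inf_commute)

lemma component_inf:
  assumes p: "component e p" and q: "component e q"
  shows "component e (inf p q)"
proof -
  have nn: "0 \<le> inf p q" using p q by (simp add: componentD)
  have "inf (inf p q) (e - p) = 0"
    by (rule disjoint_mono[OF componentD(3)[OF p]]) (use nn componentD[OF p] in auto)
  moreover have "inf (inf p q) (e - q) = 0"
    by (rule disjoint_mono[OF componentD(3)[OF q]]) (use nn componentD[OF q] in auto)
  ultimately have "inf (inf p q) (sup (e - p) (e - q)) = 0" by (rule disjoint_sup)
  moreover have "sup (e - p) (e - q) = e - inf p q"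
    by (simp add: diff_inf_eq_sup add_sup_distrib_left)
  ultimately show ?thesis by (simp add: component_def)
qed

lemma component_sup:
  assumes "component e p" "component e q"
  shows "component e (sup p q)"
proof -
  have "e - inf (e - p) (e - q) = sup p q"
    by (simp add: diff_inf_eq_sup add_sup_distrib_left)
  then show ?thesis using component_compl[OF component_inf[OF assms[THEN component_compl]]] by simp
qed

section \<open>Strong units measured against \<open>e\<close>\<close>

lemma strong_unitD:
  assumes "strong_unit e" "0 \<le> e"
  shows "\<exists>\<alpha>>0. \<bar>x\<bar> \<le> \<alpha> *\<^sub>R e"
  using assms by (simp add: strong_unit_def)

lemma strong_unit_iff:
  fixes e :: "'a::vector_lattice"
  assumes "strong_unit e" "0 \<le> e"
  shows "strong_unit u \<longleftrightarrow> (\<exists>K>0. e \<le> K *\<^sub>R \<bar>u\<bar>)"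
proof
  assume "strong_unit u"
  then show "\<exists>K>0. e \<le> K *\<^sub>R \<bar>u\<bar>"
    using assms(2) unfolding strong_unit_def by (metis abs_of_nonneg)
next
  assume "\<exists>K>0. e \<le> K *\<^sub>R \<bar>u\<bar>"
  then obtain K where K: "K > 0" "e \<le> K *\<^sub>R \<bar>u\<bar>" by blast
  show "strong_unit u" unfolding strong_unit_def
  proof
    fix x
    obtain \<alpha> where \<alpha>: "\<alpha> > 0" "\<bar>x\<bar> \<le> \<alpha> *\<^sub>R e" using strong_unitD[OF assms] by blast
    have "\<bar>x\<bar> \<le> (\<alpha> * K) *\<^sub>R \<bar>u\<bar>"
      using \<alpha> order_trans[OF \<alpha>(2) scaleR_left_mono[OF K(2), of \<alpha>]] by simp
    then show "\<exists>\<alpha>>0. \<bar>x\<bar> \<le> \<alpha> *\<^sub>R \<bar>u\<bar>" using K \<alpha> by (meson mult_pos_pos)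
  qed
qed

lemma strong_unitI:
  fixes e :: "'a::vector_lattice"
  assumes "strong_unit e" "0 \<le> e" "0 < d" "d *\<^sub>R e \<le> \<bar>u\<bar>"
  shows "strong_unit u"
proof -
  have "inverse d *\<^sub>R (d *\<^sub>R e) \<le> inverse d *\<^sub>R \<bar>u\<bar>"
    using assms by (intro scaleR_left_mono) auto
  then have "e \<le> inverse d *\<^sub>R \<bar>u\<bar>" using assms(3) by simp
  then show ?thesis
    using strong_unit_iff[OF assms(1,2)] assms(3) inverse_positive_iff_positive by blast
qed

lemma linear_order_mono:
  fixes H :: "'a::vector_lattice \<Rightarrow> real"
  assumes "linear H" "\<And>x. 0 \<le> x \<Longrightarrow> 0 \<le> H x" "a \<le> b"
  shows "H a \<le> H b"
  using assms(2)[of "b - a"] assms(3) linear_diff[OF assms(1), of b a] by simp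

subsection \<open>Functionals on clean vector lattices\<close>

text \<open>Disjointness from \<open>a\<close> and \<open>b\<close> passes to
  \<open>K *\<^sub>R (a + b)\<close>, which dominates \<open>e\<close> and so \<open>w\<close>; thus
  \<open>w\<close> is disjoint from itself.\<close>

lemma disjoint_from_unit_diff:
  fixes e :: "'a::vector_lattice"
  assumes "e \<le> K *\<^sub>R \<bar>a - b\<bar>" "K > 0" "w \<le> e" "inf w a = 0" "inf w b = 0"
  shows "w = 0"
proof -
  have w: "0 \<le> w" and ab: "0 \<le> a" "0 \<le> b"
    using disjoint_nonneg[OF assms(4)] disjoint_nonneg[OF assms(5)] by auto
  have "\<bar>a - b\<bar> \<le> a + b" using abs_triangle_ineq4[of a b] ab by simp
  then have "w \<le> K *\<^sub>R (a + b)"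
    using assms scaleR_left_mono[of "\<bar>a - b\<bar>" "a + b" K] by (meson less_imp_le order_trans)
  moreover have "inf w (K *\<^sub>R (a + b)) = 0"
    using assms by (intro disjoint_scaleR disjoint_add) auto
  ultimately show ?thesis by (simp add: inf_absorb1)
qed

text \<open>If \<open>H x = - c\<close> with c > 0, then \<open>x + c *\<^sub>R e\<close> is a
  strong unit on which \<open>H\<close> vanishes.\<close>

lemma unit_preserving_nonneg:
  fixes e :: "'a::vector_lattice"
  assumes e: "strong_unit e" "0 \<le> e" and H: "linear H" "unital e H" "unit_preserving H" and "0 \<le> x"
  shows "0 \<le> H x"
proof (rule ccontr)
  assume "\<not> 0 \<le> H x"
  define c where "c = - H x"
  have c: "c > 0" using \<open>\<not> 0 \<le> H x\<close> by (simp add: c_def)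
  have "c *\<^sub>R e \<le> \<bar>x + c *\<^sub>R e\<bar>"
    using abs_ge_self[of "x + c *\<^sub>R e"] assms(6) by (meson add_increasing order_refl order_trans)
  then have "strong_unit (x + c *\<^sub>R e)" by (rule strong_unitI[OF e c])
  moreover have "H (x + c *\<^sub>R e) = 0"
    using H linear_add[of H x "c *\<^sub>R e"] linear_scale[of H c e] by (simp add: unital_def c_def)
  ultimately show False using H by (simp add: unit_preserving_def)
qed

text \<open>For t = \<open>H p\<close> strictly between 0 and 1, the kernel element
  \<open>p - t *\<^sub>R e\<close> would be a strong unit: it is 1 - t times \<open>p\<close> minus
  t times the disjoint \<open>e - p\<close>, so its modulus is at least min t (1 - t) times
  \<open>e\<close>.\<close>

lemma unit_preserving_component:
  fixes e :: "'a::vector_lattice"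
  assumes e: "strong_unit e" "0 \<le> e" and H: "linear H" "unital e H" "unit_preserving H"
    and p: "component e p"
  shows "H p = 0 \<or> H p = 1"
proof (rule ccontr)
  assume not01: "\<not> ?thesis"
  note pos = unit_preserving_nonneg[OF e H]
  define t where "t = H p"
  have "H (e - p) = 1 - t" using H by (simp add: linear_diff unital_def t_def)
  then have t: "0 < t" "t < 1"
    using not01 pos[of p] pos[of "e - p"] componentD[OF p] by (auto simp: t_def)
  define s where "s = min t (1 - t)"
  have s: "0 < s" "s \<le> t" "s \<le> 1 - t" using t by (auto simp: s_def)
  have "inf ((1 - t) *\<^sub>R p) (t *\<^sub>R (e - p)) = 0"
    using disjoint_scaleR[OF _ , of "(1 - t) *\<^sub>R p" "e - p" t]
      disjoint_scaleR[of "e - p" p "1 - t"] componentD[OF p] t by (simp add: inf_commute)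
  then have "(1 - t) *\<^sub>R p + t *\<^sub>R (e - p) \<le> \<bar>(1 - t) *\<^sub>R p - t *\<^sub>R (e - p)\<bar>"
    by (rule abs_diff_disjoint)
  also have "(1 - t) *\<^sub>R p - t *\<^sub>R (e - p) = p - t *\<^sub>R e" by (simp add: algebra_simps)
  finally have 1: "(1 - t) *\<^sub>R p + t *\<^sub>R (e - p) \<le> \<bar>p - t *\<^sub>R e\<bar>" .
  have "s *\<^sub>R e = s *\<^sub>R p + s *\<^sub>R (e - p)" by (simp add: algebra_simps)
  also have "\<dots> \<le> (1 - t) *\<^sub>R p + t *\<^sub>R (e - p)"
    using s componentD[OF p] by (intro add_mono scaleR_right_mono) auto
  finally have "s *\<^sub>R e \<le> \<bar>p - t *\<^sub>R e\<bar>" using 1 by (rule order_trans)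
  then have "strong_unit (p - t *\<^sub>R e)" by (rule strong_unitI[OF e s(1)])
  moreover have "H (p - t *\<^sub>R e) = 0"
    using H by (simp add: linear_diff linear_scale unital_def t_def)
  ultimately show False using H by (simp add: unit_preserving_def)
qed

text \<open>Truncating \<open>x\<close> at the levels \<open>0\<close> and \<open>\<epsilon> e\<close> before applying cleanness forces the component to be \<open>e\<close>
  where \<open>x\<close> is negative and \<open>0\<close> where \<open>x\<close> exceeds \<open>\<epsilon> e\<close>, because \<open>p + u\<close> takes the values \<open>0\<close> and \<open>e\<close> there.\<close>

lemma clean_separates:
  fixes e :: "'a::vector_lattice"
  assumes e: "strong_unit e" "0 \<le> e" and \<epsilon>: "\<epsilon> > 0"
    and clean: "clean e (inf (inverse \<epsilon> *\<^sub>R pprt x) e)"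
  shows "\<exists>p. component e p \<and> inf (pprt (- x)) (e - p) = 0 \<and> inf (pprt (pprt x - \<epsilon> *\<^sub>R e)) p = 0"
proof -
  define y where "y = inf (inverse \<epsilon> *\<^sub>R pprt x) e"
  obtain p u where p: "component e p" and u: "strong_unit u" and y: "y = p + u"
    using clean unfolding clean_def y_def by blast
  obtain K where K: "K > 0" "e \<le> K *\<^sub>R \<bar>u\<bar>" using u strong_unit_iff[OF e] by blast
  note pp = componentD[OF p]
  have ye: "y \<le> e" by (simp add: y_def)
  have y0: "0 \<le> y" using e \<epsilon> by (simp add: y_def scaleR_nonneg_nonneg)
  define v where "v = inf (pprt (- x)) (e - p)"
  have v: "0 \<le> v" "v \<le> e - p" "v \<le> pprt (- x)" using pp by (auto simp: v_def)
  \<comment> \<open>Being below \<open>e - p\<close> and \<open>pprt (- x)\<close>, \<open>v\<close>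
    is disjoint from \<open>p\<close> and from \<open>y\<close>, whose difference is the strong unit
    \<open>u\<close>.\<close>
  have "v = 0"
  proof (rule disjoint_from_unit_diff[OF _ K(1)])
    show "e \<le> K *\<^sub>R \<bar>y - p\<bar>" using K y by simp
    show "v \<le> e" using v pp by (metis diff_le_eq add_increasing2 order_refl order_trans)
    show "inf v p = 0"
      using disjoint_mono[of "e - p" p v p] pp v by (simp add: inf_commute)
    have "inf (pprt (- x)) (inverse \<epsilon> *\<^sub>R pprt x) = 0"
      using \<epsilon> by (intro disjoint_scaleR) (auto simp: inf_commute pprt_minus_disjoint)
    then show "inf v y = 0"
      by (rule disjoint_mono) (use v y0 in \<open>auto simp: y_def\<close>)
  qed
  moreover
  define z where "z = pprt (pprt x - \<epsilon> *\<^sub>R e)"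
  define w where "w = inf z p"
  have w: "0 \<le> w" "w \<le> z" "w \<le> p" using pp by (auto simp: w_def z_def)
  \<comment> \<open>The same argument with complements: \<open>w\<close> is disjoint from
    \<open>e - p\<close> and \<open>e - y\<close>, and their difference is again
    \<open>u\<close>.\<close>
  have "w = 0"
  proof (rule disjoint_from_unit_diff[OF _ K(1)])
    show "e \<le> K *\<^sub>R \<bar>(e - p) - (e - y)\<bar>" using K y by simp
    show "w \<le> e" using w pp by (meson order_trans)
    show "inf w (e - p) = 0" by (rule disjoint_mono[OF pp(3)]) (use w pp in auto)
    \<comment> \<open>Because of the truncation at \<open>e\<close>, \<open>e - y\<close> is a
      multiple of the negative part of \<open>pprt x - \<epsilon> *\<^sub>R e\<close>, hence
      disjoint from its positive part \<open>z\<close>.\<close>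
    have "e - y = pprt (e - inverse \<epsilon> *\<^sub>R pprt x)"
      by (simp add: y_def diff_inf_eq_sup pprt_def add_sup_distrib_left)
    also have "\<dots> = inverse \<epsilon> *\<^sub>R pprt (- (pprt x - \<epsilon> *\<^sub>R e))"
      using \<epsilon> by (simp add: scaleR_pprt scaleR_diff_right)
    finally have "inf z (e - y) = 0"
      using \<epsilon> disjoint_scaleR[OF pprt_minus_disjoint[of "pprt x - \<epsilon> *\<^sub>R e"]] unfolding z_def by simp
    then show "inf w (e - y) = 0"
      by (rule disjoint_mono) (use w ye in auto)
  qed
  ultimately show ?thesis using p unfolding v_def w_def z_def by blast
qed

text \<open>Bound \<open>a\<close> by a multiple of \<open>e = p + (e - p)\<close> and cancel the
  second summand. A positive functional vanishing at \<open>p\<close> is therefore at most 0 at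
  \<open>a\<close>.\<close>

lemma le_component_of_disjoint:
  fixes e :: "'a::vector_lattice"
  assumes e: "strong_unit e" "0 \<le> e" and p: "component e p" and "inf a (e - p) = 0"
  shows "\<exists>M>0. a \<le> M *\<^sub>R p"
proof -
  obtain M where M: "M > 0" "\<bar>a\<bar> \<le> M *\<^sub>R e" using strong_unitD[OF e] by blast
  have "a \<le> M *\<^sub>R p"
  proof (rule disjoint_cancel)
    show "inf a (M *\<^sub>R (e - p)) = 0" using assms(4) M by (intro disjoint_scaleR) auto
    show "0 \<le> M *\<^sub>R p" using M componentD[OF p] by (simp add: scaleR_nonneg_nonneg)
    show "a \<le> M *\<^sub>R p + M *\<^sub>R (e - p)"
      using order_trans[OF abs_ge_self M(2)] by (simp add: algebra_simps)
  qed
  then show ?thesis using M by blast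
qed

lemma clean_imp_lattice_hom:
  fixes e :: "'a::vector_lattice"
  assumes e: "strong_unit e" "0 \<le> e" and clean: "\<And>x. clean e x"
    and H: "linear H" "unital e H" "unit_preserving H"
  shows "lattice_hom H"
  unfolding lattice_hom_def
proof
  fix x
  note pos = unit_preserving_nonneg[OF e H]
  have mono: "H a \<le> H b" if "a \<le> b" for a b
    by (rule linear_order_mono[OF H(1) pos that])
  have kill: "H a \<le> 0" if akp: "inf a (e - p) = 0" "component e p" "H p = 0" for a p
  proof -
    obtain M where "M > 0" "a \<le> M *\<^sub>R p"
      using le_component_of_disjoint[OF e akp(2,1)] by blast
    then show ?thesis using mono[of a "M *\<^sub>R p"] akp H by (simp add: linear_scale)
  qed
  have alt: "H (pprt x) \<le> \<epsilon> \<or> H (pprt (- x)) = 0" if \<epsilon>: "\<epsilon> > 0" for \<epsilon>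
  proof -
    obtain p where p: "component e p" "inf (pprt (- x)) (e - p) = 0"
      "inf (pprt (pprt x - \<epsilon> *\<^sub>R e)) p = 0"
      using clean_separates[OF e \<epsilon>] clean by blast
    from unit_preserving_component[OF e H p(1)] show ?thesis
    proof
      assume "H p = 0"
      then have "H (pprt (- x)) \<le> 0" using kill p by blast
      then show ?thesis using pos[of "pprt (- x)"] by simp
    next
      assume "H p = 1"
      then have "H (e - p) = 0" using H by (simp add: linear_diff unital_def)
      then have "H (pprt (pprt x - \<epsilon> *\<^sub>R e)) \<le> 0"
        using kill[of _ "e - p"] p component_compl[OF p(1)] by simp
      moreover have "H (pprt x - \<epsilon> *\<^sub>R e) \<le> H (pprt (pprt x - \<epsilon> *\<^sub>R e))"
        by (rule mono) (unfold pprt_def, rule sup_ge1)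
      moreover have "H (pprt x - \<epsilon> *\<^sub>R e) = H (pprt x) - \<epsilon>"
        using H by (simp add: linear_diff linear_scale unital_def)
      ultimately show ?thesis by simp
    qed
  qed
  \<comment> \<open>Were \<open>H (pprt x)\<close> positive, half of it could serve as \<epsilon> in
    \<open>alt\<close>.\<close>
  have "H (pprt x) = 0 \<or> H (pprt (- x)) = 0"
  proof (rule ccontr)
    assume "\<not> ?thesis"
    moreover have "H (pprt x) \<ge> 0" by (rule pos) simp
    ultimately show False using alt[of "H (pprt x) / 2"] by simp
  qed
  moreover have "H (pprt x) \<ge> 0" "H (pprt (- x)) \<ge> 0" by (auto intro: pos)
  moreover have "H \<bar>x\<bar> = H (pprt x) + H (pprt (- x))"
    using H by (simp add: abs_eq_pprt_add(1)[of x] linear_add)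
  moreover have "H x = H (pprt x) - H (pprt (- x))"
    using H abs_eq_pprt_add(2)[of x] by (metis linear_diff)
  ultimately show "\<bar>H x\<bar> = H \<bar>x\<bar>" by auto
qed

subsection \<open>Ideals of components and the converse\<close>

text \<open>For c = e this says that \<open>x - q\<close> is a strong unit
  (\<open>strong_unit_iff\<close>); a smaller component \<open>c\<close> asks for the same only on
  the band of \<open>c\<close>.\<close>

definition clean_below :: "'a::vector_lattice \<Rightarrow> 'a \<Rightarrow> 'a \<Rightarrow> bool" where
  "clean_below e x c \<longleftrightarrow> (\<exists>q K. component e q \<and> K > 0 \<and> c \<le> K *\<^sub>R \<bar>x - q\<bar>)"

lemma clean_if_clean_below:
  fixes e :: "'a::vector_lattice"
  assumes e: "strong_unit e" "0 \<le> e" and "clean_below e x e"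
  shows "clean e x"
proof -
  obtain q K where q: "component e q" "K > 0" "e \<le> K *\<^sub>R \<bar>x - q\<bar>"
    using assms(3) by (auto simp: clean_below_def)
  then have "strong_unit (x - q)" using strong_unit_iff[OF e] by blast
  then show ?thesis using q(1) unfolding clean_def by (metis add.commute diff_add_cancel)
qed

lemma clean_below_mono: "clean_below e x c \<Longrightarrow> d \<le> c \<Longrightarrow> clean_below e x d"
  unfolding clean_below_def by (meson order_trans)

lemma component_zero: "0 \<le> e \<Longrightarrow> component e 0" for e :: "'a::vector_lattice"
  by (simp add: component_def inf_absorb1)

lemma component_self: "0 \<le> e \<Longrightarrow> component e e" for e :: "'a::vector_lattice"
  by (simp add: component_def inf_absorb2)

text \<open>The bound \<open>\<bar>r - q\<bar> \<le> e - c\<close> says that \<open>r\<close> and \<open>q\<close> agree on the band of \<open>c\<close>.\<close>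

lemma clean_below_transfer:
  fixes e :: "'a::vector_lattice"
  assumes c: "component e c" "d \<le> c" "0 \<le> d" and K: "K > 0" "d \<le> K *\<^sub>R \<bar>x - q\<bar>"
    and close: "\<bar>r - q\<bar> \<le> e - c"
  shows "d \<le> K *\<^sub>R \<bar>x - r\<bar>"
proof (rule disjoint_cancel)
  have "inf d (e - c) = 0"
    by (rule disjoint_mono[OF componentD(3)[OF c(1)]]) (use c componentD[OF c(1)] in auto)
  then show "inf d (K *\<^sub>R (e - c)) = 0" using K by (intro disjoint_scaleR) auto
  show "0 \<le> K *\<^sub>R \<bar>x - r\<bar>" using K by (simp add: scaleR_nonneg_nonneg)
  have "\<bar>x - q\<bar> \<le> \<bar>x - r\<bar> + \<bar>r - q\<bar>" using abs_triangle_ineq[of "x - r" "r - q"] by simp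
  also have "\<dots> \<le> \<bar>x - r\<bar> + (e - c)" using close by simp
  finally have "K *\<^sub>R \<bar>x - q\<bar> \<le> K *\<^sub>R (\<bar>x - r\<bar> + (e - c))"
    using K by (intro scaleR_left_mono) auto
  then show "d \<le> K *\<^sub>R \<bar>x - r\<bar> + K *\<^sub>R (e - c)"
    using K(2) by (simp add: scaleR_add_right)
qed

text \<open>The two witnesses are glued: \<open>r\<close> agrees with \<open>q1\<close> on
  \<open>c\<close> and with \<open>q2\<close> on the complement of \<open>c\<close>.\<close>

lemma clean_below_sup:
  fixes e :: "'a::vector_lattice"
  assumes e: "0 \<le> e" and c: "component e c" "clean_below e x c"
    and d: "component e d" "clean_below e x d"
  shows "clean_below e x (sup c d)"
proof -
  obtain q1 K1 where 1: "component e q1" "K1 > 0" "c \<le> K1 *\<^sub>R \<bar>x - q1\<bar>"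
    using c by (auto simp: clean_below_def)
  obtain q2 K2 where 2: "component e q2" "K2 > 0" "d \<le> K2 *\<^sub>R \<bar>x - q2\<bar>"
    using d by (auto simp: clean_below_def)
  define c' where "c' = e - c"
  have c': "component e c'" unfolding c'_def by (rule component_compl[OF c(1)])
  define r where "r = sup (inf q1 c) (inf q2 c')"
  have r: "component e r" unfolding r_def by (intro component_sup component_inf 1 2 c c')
  note nn = componentD(1)[OF c(1)] componentD(1)[OF c'] componentD(1,2)[OF 1(1)] componentD(1,2)[OF 2(1)]
  have split: "q \<le> inf q a + b" if "0 \<le> q" "q \<le> e" "0 \<le> a" "0 \<le> b" "a + b = e" for q a b
    using that inf_add_le[of q a b] by (simp add: inf_absorb1) (meson add_left_mono inf.cobounded2 order_trans)
  have "q1 \<le> inf q1 c + c'" using nn by (intro split) (auto simp: c'_def)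
  moreover have "inf q1 c \<le> r" by (simp add: r_def)
  ultimately have "q1 \<le> r + c'" by (meson add_right_mono order_trans)
  moreover have "r \<le> q1 + c'" unfolding r_def
    using nn by (intro le_supI) (auto intro: le_infI1 le_infI2 add_increasing add_increasing2)
  ultimately have "\<bar>r - q1\<bar> \<le> e - c"
    by (intro abs_leI) (simp_all add: c'_def algebra_simps)
  then have A: "c \<le> K1 *\<^sub>R \<bar>x - r\<bar>"
    using clean_below_transfer[OF c(1) order_refl nn(1)] 1 by blast
  have "q2 \<le> inf q2 c' + c" using nn by (intro split) (auto simp: c'_def)
  moreover have "inf q2 c' \<le> r" by (simp add: r_def)
  ultimately have "q2 \<le> r + c" by (meson add_right_mono order_trans)
  moreover have "r \<le> q2 + c" unfolding r_def
    using nn by (intro le_supI) (auto intro: le_infI1 le_infI2 add_increasing add_increasing2)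
  ultimately have cl: "\<bar>r - q2\<bar> \<le> e - c'"
    by (intro abs_leI) (simp_all add: c'_def algebra_simps)
  \<comment> \<open>Only the part of \<open>d\<close> outside \<open>c\<close> relies on
    \<open>q2\<close>; the rest lies below \<open>c\<close> and is covered by \<open>A\<close>.
    Adding the bounds gives the constant \<open>K2 + K1\<close>.\<close>
  have "inf d c' \<le> K2 *\<^sub>R \<bar>x - r\<bar>"
  proof (rule clean_below_transfer[OF c' _ _ 2(2) _ cl])
    show "inf d c' \<le> K2 *\<^sub>R \<bar>x - q2\<bar>" using 2(3) by (rule le_infI1)
  qed (use nn componentD(1)[OF d(1)] in auto)
  moreover have "d \<le> inf d c' + c"
    using nn componentD[OF d(1)] by (intro split) (auto simp: c'_def)
  ultimately have B: "d \<le> K2 *\<^sub>R \<bar>x - r\<bar> + K1 *\<^sub>R \<bar>x - r\<bar>"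
    using A by (meson add_mono order_trans)
  have "c \<le> K2 *\<^sub>R \<bar>x - r\<bar> + K1 *\<^sub>R \<bar>x - r\<bar>"
    using A 2(2) by (intro add_increasing) (simp_all add: scaleR_nonneg_nonneg)
  then have "sup c d \<le> (K2 + K1) *\<^sub>R \<bar>x - r\<bar>"
    using B by (simp add: scaleR_add_left)
  then show ?thesis using r 1(2) 2(2) unfolding clean_below_def by (meson add_pos_pos)
qed

section \<open>Maximal ideals of components\<close>

definition component_ideal :: "'a::vector_lattice \<Rightarrow> 'a set \<Rightarrow> bool" where
  "component_ideal e M \<longleftrightarrow> 0 \<in> M \<and> (\<forall>m\<in>M. component e m) \<and> (\<forall>m\<in>M. \<forall>n\<in>M. sup m n \<in> M) \<and>
    (\<forall>m\<in>M. \<forall>c. component e c \<and> c \<le> m \<longrightarrow> c \<in> M)"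

lemma component_idealD:
  assumes "component_ideal e M"
  shows "0 \<in> M" "m \<in> M \<Longrightarrow> component e m" "m \<in> M \<Longrightarrow> n \<in> M \<Longrightarrow> sup m n \<in> M"
    "m \<in> M \<Longrightarrow> component e c \<Longrightarrow> c \<le> m \<Longrightarrow> c \<in> M"
  using assms unfolding component_ideal_def by blast+

text \<open>Zorn gives a maximal proper \<open>M\<close>. For a component \<open>q\<close> outside
  it, the ideal \<open>X\<close> generated by \<open>M\<close> and \<open>q\<close> contains
  \<open>e\<close>, so \<open>e \<le> sup m q \<le> m + q\<close> for some \<open>m\<close> in
  \<open>M\<close>, and \<open>e - q \<le> m\<close> lies in \<open>M\<close>.\<close>

lemma component_ideal_maximal:
  fixes e :: "'a::vector_lattice"
  assumes S: "component_ideal e S" "e \<notin> S"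
  shows "\<exists>M. component_ideal e M \<and> e \<notin> M \<and> S \<subseteq> M \<and> (\<forall>q. component e q \<longrightarrow> q \<in> M \<or> e - q \<in> M)"
proof -
  define A where "A = {M. component_ideal e M \<and> e \<notin> M \<and> S \<subseteq> M}"
  have "\<exists>M\<in>A. \<forall>X\<in>A. M \<subseteq> X \<longrightarrow> X = M"
  proof (rule subset_Zorn_nonempty)
    show "A \<noteq> {}" using S by (auto simp: A_def)
    fix C assume ne: "C \<noteq> {}" and ch: "subset.chain A C"
    have CA: "component_ideal e M" "e \<notin> M" "S \<subseteq> M" if "M \<in> C" for M
      using ch that by (auto simp: subset_chain_def A_def)
    have "component_ideal e (\<Union>C)"
      unfolding component_ideal_def
    proof (intro conjI ballI allI impI)
      show "0 \<in> \<Union>C" using ne CA(1) by (auto simp: component_ideal_def)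
      show "component e m" if "m \<in> \<Union>C" for m
        using that CA(1) by (auto simp: component_ideal_def)
      show "c \<in> \<Union>C" if "m \<in> \<Union>C" "component e c \<and> c \<le> m" for m c
        using that CA(1) unfolding component_ideal_def by blast
      show "sup m n \<in> \<Union>C" if mn: "m \<in> \<Union>C" "n \<in> \<Union>C" for m n
      proof -
        obtain M N where MN: "M \<in> C" "m \<in> M" "N \<in> C" "n \<in> N" using mn by blast
        then have "M \<subseteq> N \<or> N \<subseteq> M" using ch by (auto simp: subset_chain_def)
        then obtain L where "L \<in> C" "m \<in> L" "n \<in> L" using MN by blast
        then show ?thesis using CA(1) unfolding component_ideal_def by blast
      qed
    qed
    then show "\<Union>C \<in> A" using ne CA(2,3) by (auto simp: A_def)
  qed
  then obtain M where "M \<in> A" and max: "\<And>X. X \<in> A \<Longrightarrow> M \<subseteq> X \<Longrightarrow> X = M"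
    by blast
  then have M: "component_ideal e M" "e \<notin> M" "S \<subseteq> M" by (auto simp: A_def)
  note zero = component_idealD(1)[OF M(1)] and comp = component_idealD(2)[OF M(1)]
    and Msup = component_idealD(3)[OF M(1)] and down = component_idealD(4)[OF M(1)]
  have "e - q \<in> M" if q: "component e q" "q \<notin> M" for q
  proof -
    define X where "X = {c. component e c \<and> (\<exists>m\<in>M. c \<le> sup m q)}"
    have "component_ideal e X"
      unfolding component_ideal_def
    proof (intro conjI ballI allI impI)
      show "0 \<in> X" using comp zero unfolding X_def by (auto intro!: bexI[of _ 0])
      show "component e m" if "m \<in> X" for m using that by (simp add: X_def)
      show "c \<in> X" if "m \<in> X" "component e c \<and> c \<le> m" for m c
        using that by (auto simp: X_def intro: order_trans)
      show "sup c d \<in> X" if cd: "c \<in> X" "d \<in> X" for c d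
      proof -
        obtain m n where mn: "m \<in> M" "n \<in> M" "c \<le> sup m q" "d \<le> sup n q"
          using cd by (auto simp: X_def)
        have "sup c d \<le> sup (sup m q) (sup n q)" using mn by (intro sup_mono)
        then have "sup c d \<le> sup (sup m n) q" by (simp add: sup_assoc sup_left_commute)
        then show ?thesis using mn cd component_sup Msup unfolding X_def by blast
      qed
    qed
    moreover have "M \<subseteq> X" using comp sup_ge1 unfolding X_def by blast
    moreover have "q \<in> X" using q zero by (auto simp: X_def)
    ultimately have "e \<in> X" using max[of X] M(3) q(2) unfolding A_def by blast
    then obtain m where m: "m \<in> M" "e \<le> sup m q" by (auto simp: X_def)
    note nn = componentD[OF comp[OF m(1)]] componentD[OF q(1)]
    have "sup m q \<le> m + q" using nn by (simp add: add_increasing add_increasing2)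
    with m(2) have "e \<le> m + q" by (rule order_trans)
    then have "e - q \<le> m" by (simp add: diff_le_eq)
    then show ?thesis using down[OF m(1) component_compl[OF q(1)]] by simp
  qed
  then show ?thesis using M by blast
qed

section \<open>Functionals dominated by the gauge of an ideal\<close>

text \<open>The order-unit gauge of the quotient by the ideal generated by \<open>M\<close>. The infimum is
  over a nonempty set bounded below only if \<open>e\<close> is a strong unit outside \<open>M\<close>.\<close>

definition ideal_gauge :: "'a::vector_lattice \<Rightarrow> 'a set \<Rightarrow> 'a \<Rightarrow> real" where
  "ideal_gauge e M y = Inf {t. \<exists>k\<ge>0. \<exists>m\<in>M. y \<le> t *\<^sub>R e + k *\<^sub>R m}"

context
  fixes e :: "'a::vector_lattice" and M
  assumes e: "strong_unit e" "0 \<le> e" and M: "component_ideal e M" "e \<notin> M"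
begin

lemmas ideal_zero = component_idealD(1)[OF M(1)]
  and ideal_comp = component_idealD(2)[OF M(1)]
  and ideal_sup = component_idealD(3)[OF M(1)]

text \<open>A value t below \<open>- \<alpha>\<close> would put a positive multiple of
  \<open>e\<close> under \<open>k *\<^sub>R m\<close>. Since \<open>e - m\<close> is disjoint from
  \<open>m\<close>, this forces \<open>e = m\<close>, contrary to properness.\<close>

lemma ideal_gauge_bdd: "bdd_below {t. \<exists>k\<ge>0. \<exists>m\<in>M. y \<le> t *\<^sub>R e + k *\<^sub>R m}"
proof -
  obtain \<alpha> where \<alpha>: "\<alpha> > 0" "\<bar>y\<bar> \<le> \<alpha> *\<^sub>R e" using strong_unitD[OF e] by blast
  have "- \<alpha> \<le> t" if km: "k \<ge> 0" "m \<in> M" "y \<le> t *\<^sub>R e + k *\<^sub>R m" for t k m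
  proof (rule ccontr)
    assume "\<not> - \<alpha> \<le> t"
    define s where "s = - \<alpha> - t"
    have s: "s > 0" using \<open>\<not> - \<alpha> \<le> t\<close> by (simp add: s_def)
    note m = componentD[OF ideal_comp[OF km(2)]]
    have "- (\<alpha> *\<^sub>R e) \<le> y" using \<alpha>(2) by (meson abs_ge_minus_self minus_le_iff order_trans)
    then have "- (\<alpha> *\<^sub>R e) \<le> t *\<^sub>R e + k *\<^sub>R m" using km(3) by (rule order_trans)
    then have "s *\<^sub>R e \<le> k *\<^sub>R m" by (simp add: s_def algebra_simps) 
    moreover have "s *\<^sub>R (e - m) \<le> s *\<^sub>R e" using s m by (intro scaleR_left_mono) auto
    ultimately have "s *\<^sub>R (e - m) \<le> 0 + k *\<^sub>R m" by (simp add: order_trans)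
    moreover have "inf (s *\<^sub>R (e - m)) (k *\<^sub>R m) = 0"
      using m(3) s km(1) by (metis disjoint_scaleR inf_commute less_imp_le)
    ultimately have "s *\<^sub>R (e - m) \<le> 0" using disjoint_cancel by blast
    moreover have "0 \<le> s *\<^sub>R (e - m)" using s m by (simp add: scaleR_nonneg_nonneg)
    ultimately have "s *\<^sub>R (e - m) = 0" by (rule antisym)
    then have "e = m" using s by simp
    then show False using M km by simp
  qed
  then show ?thesis by (intro bdd_belowI[of _ "- \<alpha>"]) auto
qed

lemma ideal_gauge_le:
  assumes "y \<le> t *\<^sub>R e + k *\<^sub>R m" "k \<ge> 0" "m \<in> M"
  shows "ideal_gauge e M y \<le> t"
  unfolding ideal_gauge_def using assms by (intro cInf_lower ideal_gauge_bdd) auto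

text \<open>The infimum may fail to be attained, but the admissible t are closed upwards because
  \<open>e\<close> is nonnegative.\<close>

lemma ideal_gauge_lt:
  assumes "ideal_gauge e M y < s"
  shows "\<exists>k\<ge>0. \<exists>m\<in>M. y \<le> s *\<^sub>R e + k *\<^sub>R m"
proof -
  obtain \<alpha> where "\<alpha> > 0" "\<bar>y\<bar> \<le> \<alpha> *\<^sub>R e" using strong_unitD[OF e] by blast
  then have "y \<le> \<alpha> *\<^sub>R e + 0 *\<^sub>R 0" using order_trans[OF abs_ge_self] by simp
  then have "{t. \<exists>k\<ge>0. \<exists>m\<in>M. y \<le> t *\<^sub>R e + k *\<^sub>R m} \<noteq> {}"
    using ideal_zero by blast
  from cInf_lessD[OF this assms[unfolded ideal_gauge_def]]
  obtain t k m where t: "t < s" "k \<ge> 0" "m \<in> M" "y \<le> t *\<^sub>R e + k *\<^sub>R m" by blast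
  have "t *\<^sub>R e + k *\<^sub>R m \<le> s *\<^sub>R e + k *\<^sub>R m"
    using t(1) e(2) by (intro add_right_mono scaleR_right_mono) auto
  then show ?thesis using t order_trans by blast
qed

lemma sublinear_ideal_gauge: "sublinear (ideal_gauge e M)"
proof (rule sublinearI)
  fix x y
  have *: "ideal_gauge e M (x + y) \<le> s + t"
    if st: "ideal_gauge e M x < s" "ideal_gauge e M y < t" for s t
  proof -
    obtain k m where 1: "k \<ge> 0" "m \<in> M" "x \<le> s *\<^sub>R e + k *\<^sub>R m" using ideal_gauge_lt[OF st(1)] by blast
    obtain l n where 2: "l \<ge> 0" "n \<in> M" "y \<le> t *\<^sub>R e + l *\<^sub>R n" using ideal_gauge_lt[OF st(2)] by blast
    have "x + y \<le> (s *\<^sub>R e + k *\<^sub>R m) + (t *\<^sub>R e + l *\<^sub>R n)" using 1 2 by (intro add_mono)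
    \<comment> \<open>A single ideal element must serve both summands; \<open>sup m n\<close>
      does.\<close>
    also have "\<dots> \<le> (s *\<^sub>R e + k *\<^sub>R sup m n) + (t *\<^sub>R e + l *\<^sub>R sup m n)"
      using 1 2 by (intro add_mono order_refl scaleR_left_mono) auto
    also have "\<dots> = (s + t) *\<^sub>R e + (k + l) *\<^sub>R sup m n" by (simp add: algebra_simps)
    finally show ?thesis
      by (rule ideal_gauge_le) (use 1 2 ideal_sup in auto)
  qed
  show "ideal_gauge e M (x + y) \<le> ideal_gauge e M x + ideal_gauge e M y"
  proof (rule field_le_epsilon)
    fix d :: real assume "d > 0"
    then show "ideal_gauge e M (x + y) \<le> ideal_gauge e M x + ideal_gauge e M y + d"
      using *[of "ideal_gauge e M x + d / 2" "ideal_gauge e M y + d / 2"] by simp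
  qed
next
  show "ideal_gauge e M 0 \<le> 0" using ideal_gauge_le[of 0 0 0 0] ideal_zero by simp
next
  fix c :: real and x assume c: "c > 0"
  have *: "ideal_gauge e M (c *\<^sub>R x) \<le> c * s" if s: "ideal_gauge e M x < s" for s
  proof -
    obtain k m where 1: "k \<ge> 0" "m \<in> M" "x \<le> s *\<^sub>R e + k *\<^sub>R m" using ideal_gauge_lt[OF s] by blast
    then have "c *\<^sub>R x \<le> c *\<^sub>R (s *\<^sub>R e + k *\<^sub>R m)" using c by (intro scaleR_left_mono) auto
    then have "c *\<^sub>R x \<le> (c * s) *\<^sub>R e + (c * k) *\<^sub>R m" by (simp add: scaleR_add_right)
    then show ?thesis by (rule ideal_gauge_le) (use 1 c in auto)
  qed
  show "ideal_gauge e M (c *\<^sub>R x) \<le> c * ideal_gauge e M x"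
  proof (rule field_le_epsilon)
    fix d :: real assume "d > 0"
    then show "ideal_gauge e M (c *\<^sub>R x) \<le> c * ideal_gauge e M x + d"
      using *[of "ideal_gauge e M x + d / c"] c by (simp add: distrib_left)
  qed
qed

text \<open>Everything follows from domination at suitable points: \<open>e\<close> and
  \<open>- e\<close> fix the value 1, \<open>- x\<close> yields positivity, and \<open>m\<close>
  itself yields \<open>f m \<le> 0\<close>.\<close>

lemma dominated_by_ideal_gauge:
  assumes f: "linear f" and dom: "\<And>x. f x \<le> ideal_gauge e M x"
  shows "f e = 1" and "0 \<le> x \<Longrightarrow> 0 \<le> f x" and "m \<in> M \<Longrightarrow> f m = 0"
proof -
  have bound: "f y \<le> t" if "y \<le> t *\<^sub>R e + k *\<^sub>R m" "k \<ge> 0" "m \<in> M" for y t k m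
    using ideal_gauge_le[OF that] dom[of y] by linarith
  have neg: "f (- y) = - f y" for y using linear_neg[OF f] .
  show "f e = 1"
    using bound[of e 1 0 0] bound[of "- e" "- 1" 0 0] ideal_zero by (simp add: neg)
  show pos: "0 \<le> f x" if "0 \<le> x" for x
    using bound[of "- x" 0 0 0] ideal_zero that by (simp add: neg)
  show "f m = 0" if "m \<in> M"
    using bound[of m 0 1 m] pos[of m] componentD(1)[OF ideal_comp[OF that]] that by simp
qed

end

text \<open>A strong unit determines a component \<open>q\<close> that separates its positive from
  its negative part. \<open>H\<close> kills \<open>q\<close> or \<open>e - q\<close>, hence one of
  the two parts, but not their sum \<open>\<bar>u\<bar>\<close>.\<close>

lemma unit_preserving_if_two_valued:
  fixes e :: "'a::vector_lattice"
  assumes e: "strong_unit e" "0 \<le> e" and H: "linear H" "H e = 1" "\<And>x. 0 \<le> x \<Longrightarrow> 0 \<le> H x"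
    and two: "\<And>q. component e q \<Longrightarrow> H q = 0 \<or> H (e - q) = 0"
  shows "unit_preserving H"
  unfolding unit_preserving_def
proof (intro allI impI)
  fix u :: 'a assume "strong_unit u"
  then obtain K where K: "K > 0" "e \<le> K *\<^sub>R \<bar>u\<bar>" using strong_unit_iff[OF e] by blast
  have mono: "H a \<le> H b" if "a \<le> b" for a b by (rule linear_order_mono[OF H(1,3) that])
  \<comment> \<open>As \<open>e\<close> is at most
    \<open>K *\<^sub>R pprt u + K *\<^sub>R pprt (- u)\<close>, truncating the first summand at
    \<open>e\<close> leaves \<open>e - q\<close> below the second; so \<open>q\<close> and
    \<open>e - q\<close> are disjoint.\<close>
  define q where "q = inf (K *\<^sub>R pprt u) e"
  have q0: "0 \<le> q" "q \<le> e" using K e(2) by (simp_all add: q_def scaleR_nonneg_nonneg)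
  have "e - q = sup (e - K *\<^sub>R pprt u) 0"
    by (simp add: q_def diff_inf_eq_sup add_sup_distrib_left)
  also have "\<dots> \<le> K *\<^sub>R pprt (- u)"
    using K by (simp add: abs_eq_pprt_add(1)[of u] scaleR_add_right diff_le_eq add.commute scaleR_nonneg_nonneg)
  finally have eq: "e - q \<le> K *\<^sub>R pprt (- u)" .
  have disj: "inf (pprt u) (K *\<^sub>R pprt (- u)) = 0"
    using K by (intro disjoint_scaleR pprt_minus_disjoint) simp
  have "inf (pprt (- u)) (K *\<^sub>R pprt u) = 0"
    using K by (intro disjoint_scaleR) (simp_all add: pprt_minus_disjoint inf_commute)
  then have u2: "inf (pprt (- u)) (e - (e - q)) = 0"
    by (rule disjoint_mono) (use q0 in \<open>simp_all add: q_def\<close>)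
  have u1: "inf (pprt u) (e - q) = 0"
    by (rule disjoint_mono[OF disj]) (use q0 eq in simp_all)
  have "inf (K *\<^sub>R pprt u) (K *\<^sub>R pprt (- u)) = 0"
    using disjoint_scaleR[of "K *\<^sub>R pprt (- u)" "pprt u" K] disj K by (simp add: inf_commute)
  then have q: "component e q" unfolding component_def
  proof (rule disjoint_mono)
    show "q \<le> K *\<^sub>R pprt u" by (simp add: q_def)
  qed (use q0 eq in simp_all)
  have kill: "H a \<le> 0" if akp: "inf a (e - p) = 0" "component e p" "H p = 0" for a p
  proof -
    obtain N where "N > 0" "a \<le> N *\<^sub>R p"
      using le_component_of_disjoint[OF e akp(2,1)] by blast
    then show ?thesis using mono[of a "N *\<^sub>R p"] akp linear_scale[OF H(1)] by simp
  qed
  have "1 \<le> K * H \<bar>u\<bar>" using mono[OF K(2)] H(2) linear_scale[OF H(1)] by simp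
  then have abs: "H \<bar>u\<bar> > 0" using K by (smt (verit) mult_nonneg_nonpos)
  have sums: "H \<bar>u\<bar> = H (pprt u) + H (pprt (- u))" "H u = H (pprt u) - H (pprt (- u))"
    using linear_add[OF H(1)] linear_diff[OF H(1)] abs_eq_pprt_add[of u] by metis+
  have nn: "H (pprt u) \<ge> 0" "H (pprt (- u)) \<ge> 0" by (simp_all add: H(3))
  from two[OF q] show "H u \<noteq> 0"
  proof
    assume "H q = 0"
    then have "H (pprt u) \<le> 0" using kill u1 q by blast
    then show ?thesis using abs sums nn by linarith
  next
    assume "H (e - q) = 0"
    then have "H (pprt (- u)) \<le> 0" using kill u2 component_compl[OF q] by blast
    then show ?thesis using abs sums nn by linarith
  qed
qed

text \<open>Restricting the bound to \<open>e - m\<close> removes the term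
  \<open>k *\<^sub>R m\<close>; this turns estimates modulo the ideal into genuine ones.\<close>

lemma clean_below_compl_of_bound:
  fixes e :: "'a::vector_lattice"
  assumes m: "component e m" and q: "component e q" and s: "s > 0" and k: "k \<ge> 0"
    and b: "s *\<^sub>R e \<le> \<bar>x - q\<bar> + k *\<^sub>R m"
  shows "clean_below e x (e - m)"
proof -
  note mm = componentD[OF m]
  have "s *\<^sub>R (e - m) \<le> s *\<^sub>R e" using s mm by (intro scaleR_left_mono) auto
  then have "s *\<^sub>R (e - m) \<le> \<bar>x - q\<bar> + k *\<^sub>R m" using b by (rule order_trans)
  moreover have "inf (s *\<^sub>R (e - m)) (k *\<^sub>R m) = 0"
    using mm(3) s k by (metis disjoint_scaleR inf_commute less_imp_le)
  ultimately have "s *\<^sub>R (e - m) \<le> \<bar>x - q\<bar>" using disjoint_cancel abs_ge_zero by blast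
  then have "inverse s *\<^sub>R (s *\<^sub>R (e - m)) \<le> inverse s *\<^sub>R \<bar>x - q\<bar>"
    using s by (intro scaleR_left_mono) auto
  then have "e - m \<le> inverse s *\<^sub>R \<bar>x - q\<bar>" using s by simp
  then show ?thesis using q s unfolding clean_below_def
    using inverse_positive_iff_positive by blast
qed

lemma lattice_hom_imp_clean:
  fixes e :: "'a::vector_lattice"
  assumes e: "strong_unit e" "0 \<le> e"
    and hom: "\<And>H :: 'a \<Rightarrow> real. linear H \<Longrightarrow> unital e H \<Longrightarrow> unit_preserving H \<Longrightarrow> lattice_hom H"
  shows "clean e x"
proof (rule ccontr)
  assume nc: "\<not> clean e x"
  define S where "S = {c. component e c \<and> clean_below e x c}"
  have "clean_below e x 0"
    unfolding clean_below_def using component_zero[OF e(2)] by (intro exI[of _ 0] exI[of _ 1]) simp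
  then have "component_ideal e S"
    unfolding component_ideal_def S_def
    using component_zero[OF e(2)] clean_below_sup[OF e(2)] component_sup clean_below_mono by blast
  moreover have "e \<notin> S" using nc clean_if_clean_below[OF e] by (auto simp: S_def)
  ultimately obtain M where M: "component_ideal e M" "e \<notin> M" "S \<subseteq> M"
    and prime: "\<And>q. component e q \<Longrightarrow> q \<in> M \<or> e - q \<in> M"
    using component_ideal_maximal by blast
  \<comment> \<open>Cleanness below \<open>e - m\<close> would put \<open>e - m\<close> into S
    \<subseteq> M, and its supremum with \<open>m\<close> is \<open>e\<close>.\<close>
  have contra: False if m: "m \<in> M" "clean_below e x (e - m)" for m
  proof -
    have cm: "component e m" by (rule component_idealD(2)[OF M(1) m(1)])
    then have "e - m \<in> M" using m(2) component_compl M(3) by (auto simp: S_def)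
    then have "sup m (e - m) \<in> M" by (rule component_idealD(3)[OF M(1) m(1)])
    moreover have "sup m (e - m) = e"
      using add_eq_inf_sup[of m "e - m"] componentD(3)[OF cm] by simp
    ultimately show False using M(2) by simp
  qed
  define p where "p = ideal_gauge e M"
  have p: "sublinear p" unfolding p_def by (rule sublinear_ideal_gauge[OF e M(1,2)])
  note cM = component_idealD(2)[OF M(1)]
  \<comment> \<open>If \<open>p x < 1\<close>, then modulo \<open>M\<close> the element
    \<open>e - x\<close> dominates a positive multiple of \<open>e\<close>, so the component
    \<open>e\<close> is a cleanness witness off some \<open>m\<close>.\<close>
  have p1: "1 \<le> p x"
  proof (rule ccontr)
    assume "\<not> 1 \<le> p x"
    then obtain t where t: "p x < t" "t < 1" using dense[of "p x" 1] by auto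
    obtain k m where km: "k \<ge> 0" "m \<in> M" "x \<le> t *\<^sub>R e + k *\<^sub>R m"
      using ideal_gauge_lt[OF e M(1,2)] t(1) unfolding p_def by blast
    have "(1 - t) *\<^sub>R e \<le> - (x - e) + k *\<^sub>R m"
      using km(3) by (simp add: algebra_simps)
    also have "\<dots> \<le> \<bar>x - e\<bar> + k *\<^sub>R m" by (intro add_right_mono abs_ge_minus_self)
    finally have "clean_below e x (e - m)"
      using km(1) t(2) by (intro clean_below_compl_of_bound[OF cM[OF km(2)] component_self[OF e(2)]]) auto
    then show False by (rule contra[OF km(2)])
  qed
  \<comment> \<open>Dually, if \<open>p (- x) < 0\<close>, then \<open>x\<close> itself is bounded
    away from 0 modulo \<open>M\<close>, and the component 0 is the witness.\<close>
  have p2: "0 \<le> p (- x)"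
  proof (rule ccontr)
    assume "\<not> 0 \<le> p (- x)"
    then obtain t where t: "p (- x) < t" "t < 0" using dense[of "p (- x)" 0] by auto
    obtain k m where km: "k \<ge> 0" "m \<in> M" "- x \<le> t *\<^sub>R e + k *\<^sub>R m"
      using ideal_gauge_lt[OF e M(1,2)] t(1) unfolding p_def by blast
    have "(- t) *\<^sub>R e \<le> (x - 0) + k *\<^sub>R m"
      using add_left_mono[OF km(3), of "x - t *\<^sub>R e"] by simp
    also have "\<dots> \<le> \<bar>x - 0\<bar> + k *\<^sub>R m" by (intro add_right_mono abs_ge_self)
    finally have "clean_below e x (e - m)"
      using km(1) t(2) by (intro clean_below_compl_of_bound[OF cM[OF km(2)] component_zero[OF e(2)], of "- t"]) auto
    then show False by (rule contra[OF km(2)])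
  qed
  obtain F where F: "linear F" "\<And>y. F y \<le> p y" "F x = p x"
    using hahn_banach_sublinear[OF p, of x] by blast
  obtain G where G: "linear G" "\<And>y. G y \<le> p y" "G (- x) = p (- x)"
    using hahn_banach_sublinear[OF p, of "- x"] by blast
  note Fd = dominated_by_ideal_gauge[OF e M(1,2) F(1) F(2)[unfolded p_def]]
  note Gd = dominated_by_ideal_gauge[OF e M(1,2) G(1) G(2)[unfolded p_def]]
  define H where "H y = (F y + G y) / 2" for y
  have lin: "linear H"
    by (rule linearI)
      (simp_all add: H_def linear_add[OF F(1)] linear_add[OF G(1)] linear_scale[OF F(1)] linear_scale[OF G(1)] field_simps)
  have He: "H e = 1" using Fd(1) Gd(1) by (simp add: H_def)
  have "unit_preserving H"
  proof (rule unit_preserving_if_two_valued[OF e lin He])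
    show "0 \<le> H y" if "0 \<le> y" for y using Fd(2)[OF that] Gd(2)[OF that] by (simp add: H_def)
    show "H q = 0 \<or> H (e - q) = 0" if "component e q" for q
      using prime[OF that] Fd(3) Gd(3) by (auto simp: H_def)
  qed
  then have "lattice_hom H" using hom lin He by (simp add: unital_def)
  moreover define y where "y = x - H x *\<^sub>R e"
  moreover have "H y = 0" using He by (simp add: y_def linear_diff[OF lin] linear_scale[OF lin])
  ultimately have "H \<bar>y\<bar> = 0" unfolding lattice_hom_def by (metis abs_zero)
  \<comment> \<open>Two nonnegative numbers with mean 0 both vanish.\<close>
  then have 0: "F \<bar>y\<bar> = 0" "G \<bar>y\<bar> = 0"
    using Fd(2)[of "\<bar>y\<bar>"] Gd(2)[of "\<bar>y\<bar>"] by (simp_all add: H_def)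
  have "F y \<le> F \<bar>y\<bar>" by (rule linear_order_mono[OF F(1) Fd(2) abs_ge_self])
  moreover have "G (- y) \<le> G \<bar>y\<bar>" by (rule linear_order_mono[OF G(1) Gd(2) abs_ge_minus_self])
  \<comment> \<open>Thus \<open>F x \<le> G x\<close>, whereas \<open>F x = p x \<ge> 1\<close> and
    \<open>G x = - p (- x) \<le> 0\<close>.\<close>
  ultimately have "F x \<le> H x" "H x \<le> G x"
    using 0 Fd(1) Gd(1)
    by (simp_all add: y_def linear_diff[OF F(1)] linear_diff[OF G(1)] linear_scale[OF F(1)] linear_scale[OF G(1)])
  moreover have "G x = - p (- x)" using G(3) linear_neg[OF G(1), of x] by simp
  ultimately show False using F(3) p1 p2 by simp
qed

theorem theorem4:
  fixes e :: "'a::vector_lattice"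
  assumes "strong_unit e" and "e > 0"
  shows "(\<forall>H :: 'a \<Rightarrow> real. linear H \<and> unital e H \<and> unit_preserving H \<longrightarrow> lattice_hom H)
    \<longleftrightarrow> (\<forall>x :: 'a. clean e x)"
  using assms clean_imp_lattice_hom[of e] lattice_hom_imp_clean[of e] by auto

end
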